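(* The five term relation for dilogarithms holds: for $(z_1,z_2)\in\mathbf C^2$ in a neighbourhood of $(0,0)$, $$\mathrm{Li}_2(z_1z_2)=\mathrm{Li}_2\!\left(\frac{-z_1(1-z_2)}{1-z_1}\right)+\mathrm{Li}_2\!\left(\frac{-z_2(1-z_1)}{1-z_2}\right)+\mathrm{Li}_2(z_1)+\mathrm{Li}_2(z_2)+\frac12\log^2\!\left(\frac{1-z_1}{1-z_2}\right).$$
   Context: $\mathrm{Li}_2(z)=\sum_{n\ge1}z^n/n^2$ for $|z|<1$, and $\log$ is the branch with $\log 1=0$ (principal branch). The identity is one between analytic functions, so it extends from the neighbourhood of $(0,0)$ by analytic continuation. *)

theory Defs
  imports "HOL-Analysis.Analysis"
begin

(* The sum over n \<ge> 1 is indexed by Suc n. Only values at norm z < 1 are meaningful: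
   outside the closed unit disc the series diverges and suminf is unspecified. *)
definition Li2 :: "complex \<Rightarrow> complex" where
  "Li2 z = (\<Sum>n. z ^ Suc n / of_nat (Suc n) ^ 2)"

end

theory Submission
  imports Defs
begin

text \<open>
  The identity is proved by differentiating in one variable. Everything rests on the differential
  equation \<open>z * Li2' z = - Ln (1 - z)\<close> in the unit disc (\<open>Li2_derivative\<close>).

  Fix \<open>w\<close>, and put \<open>A = - z (1 - w) / (1 - z)\<close> and \<open>B = - w (1 - z) / (1 - w)\<close>. The two arguments are
  chosen so that \<open>1 - A = (1 - z w) / (1 - z)\<close> and \<open>1 - B = (1 - z w) / (1 - w)\<close>; their logarithms
  are therefore differences of logarithms of \<open>1 - z\<close>, \<open>1 - w\<close> and \<open>1 - z w\<close>. Since the logarithmic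
  derivatives of \<open>A\<close> and \<open>B\<close> in \<open>z\<close> are \<open>1 / z + 1 / (1 - z)\<close> and \<open>- 1 / (1 - z)\<close>, the derivative
  of the difference of the two sides is a rational combination of three logarithms in which
  everything cancels (\<open>five_term_defect_derivative\<close>). Hence the difference does not depend on \<open>z\<close>.

  The difference is moreover symmetric in \<open>z\<close> and \<open>w\<close>. So its value at \<open>(z, w)\<close> is its value
  at \<open>(0, w)\<close>, hence at \<open>(w, 0)\<close>, hence at \<open>(0, 0)\<close>, where it vanishes. In particular the case
  \<open>z = 0\<close>, which is Landen's identity, needs no separate argument.
\<close>

lemma Li2_0 [simp]: "Li2 0 = 0"
  by (simp add: Li2_def)

text \<open>
  The equation is kept in multiplied form: this avoids the removable singularity of
  \<open>- Ln (1 - z) / z\<close> at the origin, which the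
  arguments of the five term relation meet when \<open>z\<close> or \<open>w\<close> is 0.
\<close>

lemma Li2_derivative:
  assumes z: "norm z < 1"
  obtains D where "(Li2 has_field_derivative D) (at z)" and "z * D = - Ln (1 - z)"
proof -
  define c :: "nat \<Rightarrow> complex" where "c n = 1 / of_nat n ^ 2" for n
  have sm: "summable (\<lambda>n. c n * x ^ n)" if x: "norm x < 1" for x
  proof (rule summable_comparison_test')
    show "summable (\<lambda>n. norm x ^ n)"
      using x by (simp add: summable_geometric)
    show "norm (c n * x ^ n) \<le> norm x ^ n" if "n \<ge> 0" for n
    proof (cases n)
      case (Suc m)
      have "1 \<le> (real n)\<^sup>2"
        by (simp add: Suc)
      then show ?thesis
        by (simp add: c_def norm_mult norm_divide norm_power divide_le_eq mult_le_cancel_left1)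
    qed (simp add: c_def)
  qed
  \<comment> \<open>The constant coefficient is \<open>1 / 0 = 0\<close>, so starting the series at index 0 changes nothing.\<close>
  have Li2_eq: "(\<Sum>n. c n * x ^ n) = Li2 x" if "norm x < 1" for x
    using suminf_split_head[OF sm[OF that]] by (simp add: Li2_def c_def)
  define D where "D = (\<Sum>n. diffs c n * z ^ n)"
  have "((\<lambda>x. \<Sum>n. c n * x ^ n) has_field_derivative D) (at z)"
    unfolding D_def by (rule termdiffs_strong'[OF sm z])
  then have deriv: "(Li2 has_field_derivative D) (at z)"
    by (rule has_field_derivative_transform_within_open[where S = "ball 0 1"])
       (use z Li2_eq in auto)
  have diffs_c: "diffs c n = 1 / of_nat (Suc n)" for n
    by (simp add: diffs_def c_def power2_eq_square del: of_nat_Suc)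
  have "(\<lambda>n. - (z ^ n) / of_nat n) sums Ln (1 - z)"
    using Ln_series'[of "- z"] z by simp
  then have "(\<lambda>n. - (z ^ Suc n) / of_nat (Suc n)) sums Ln (1 - z)"
    by (subst sums_Suc_iff) simp
  then have "(\<lambda>n. z * (diffs c n * z ^ n)) sums (- Ln (1 - z))"
    using sums_minus by (fastforce simp: diffs_c)
  moreover have "summable (\<lambda>n. diffs c n * z ^ n)"
    by (rule termdiff_converges[OF z sm])
  ultimately have "z * D = - Ln (1 - z)"
    unfolding D_def by (simp add: suminf_mult sums_iff)
  with deriv show ?thesis
    by (rule that)
qed

text \<open>
  In the right half plane arguments stay below \<open>\<pi> / 2\<close> in absolute value, so no branch jump
  can occur in a quotient.
\<close>

lemma Ln_divide_right_half_plane: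
  assumes "Re a > 0" and "Re b > 0"
  shows "Ln (a / b) = Ln a - Ln b"
proof (rule Ln_unique)
  have "a \<noteq> 0" "b \<noteq> 0"
    using assms by auto
  then show "exp (Ln a - Ln b) = a / b"
    by (simp add: exp_diff)
  show "- pi < Im (Ln a - Ln b)" "Im (Ln a - Ln b) \<le> pi"
    using Re_Ln_pos_lt_imp[OF assms(1)] Re_Ln_pos_lt_imp[OF assms(2)] by auto
qed

lemma Re_one_minus_pos:
  assumes "norm z < 1"
  shows "Re (1 - z) > 0"
  using complex_Re_le_cmod[of z] assms by simp

text \<open>
  The quotient inside the logarithm is already split into a difference, which makes the symmetry
  in \<open>z\<close> and \<open>w\<close> visible.
\<close>

definition five_term_defect :: "complex \<Rightarrow> complex \<Rightarrow> complex" where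
  "five_term_defect z w =
     Li2 (- z * (1 - w) / (1 - z)) + Li2 (- w * (1 - z) / (1 - w))
     + Li2 z + Li2 w + 1 / 2 * (Ln (1 - z) - Ln (1 - w)) ^ 2 - Li2 (z * w)"

lemma five_term_defect_commute: "five_term_defect z w = five_term_defect w z"
  by (simp add: five_term_defect_def power2_commute mult.commute)

lemma five_term_defect_0_0: "five_term_defect 0 0 = 0"
  by (simp add: five_term_defect_def)

text \<open>
  This keeps both inner arguments in the disc where the series for \<open>Li2\<close> converges. Bounding the
  factors \<open>z\<close>, \<open>1 - w\<close> and \<open>1 - z\<close> separately gives at most \<open>1/3 * (4/3) / (2/3) = 2/3\<close>.
\<close>

lemma norm_five_term_argument_less_1:
  fixes z w :: complex
  assumes "norm z < 1 / 3" and "norm w < 1 / 3"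
  shows "norm (- z * (1 - w) / (1 - z)) < 1"
proof -
  have w: "norm (1 - w) \<le> 4 / 3"
    using norm_triangle_ineq4[of 1 w] assms by simp
  have z: "norm (1 - z) \<ge> 2 / 3"
    using norm_triangle_ineq2[of 1 z] assms by simp
  have "norm z * norm (1 - w) \<le> 1 / 3 * (4 / 3)"
    using assms w by (intro mult_mono) auto
  also have "\<dots> < norm (1 - z)"
    using z by simp
  finally show ?thesis
    using z by (simp add: norm_mult norm_divide divide_less_eq)
qed

text \<open>
  Multiplying by \<open>z\<close> turns each term of the derivative into a logarithm with a rational
  coefficient, by \<open>Li2_derivative\<close>; this leaves \<open>z = 0\<close> as the only point without information.
\<close>

lemma five_term_defect_derivative:
  assumes z: "norm z < 1 / 3" and w: "norm w < 1 / 3"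
  obtains D where "((\<lambda>z. five_term_defect z w) has_field_derivative D) (at z)" and "z * D = 0"
proof -
  define A where "A = (\<lambda>z. - z * (1 - w) / (1 - z))"
  define B where "B = (\<lambda>z. - w * (1 - z) / (1 - w))"
  have ne: "1 - z \<noteq> 0" "1 - w \<noteq> 0"
    using z w by auto
  have zw: "norm (z * w) < 1"
    using mult_strict_mono'[OF z w] by (simp add: norm_mult)
  obtain DA where DA: "(Li2 has_field_derivative DA) (at (A z))" "A z * DA = - Ln (1 - A z)"
    using Li2_derivative norm_five_term_argument_less_1[OF z w] unfolding A_def by blast
  obtain DB where DB: "(Li2 has_field_derivative DB) (at (B z))" "B z * DB = - Ln (1 - B z)"
    using Li2_derivative norm_five_term_argument_less_1[OF w z] unfolding B_def by blast
  obtain Dz where Dz: "(Li2 has_field_derivative Dz) (at z)" "z * Dz = - Ln (1 - z)"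
    using Li2_derivative[of z] z by auto
  obtain Dp where Dp: "(Li2 has_field_derivative Dp) (at (z * w))" "z * w * Dp = - Ln (1 - z * w)"
    using Li2_derivative[OF zw] by blast
  have pos: "Re (1 - z) > 0" "Re (1 - w) > 0" "Re (1 - z * w) > 0"
    using z w zw by (auto intro!: Re_one_minus_pos simp del: minus_complex.sel)
  have LnA: "Ln (1 - A z) = Ln (1 - z * w) - Ln (1 - z)"
  proof -
    have "1 - A z = (1 - z * w) / (1 - z)"
      using ne by (simp add: A_def field_simps)
    then show ?thesis
      using Ln_divide_right_half_plane pos by simp
  qed
  have LnB: "Ln (1 - B z) = Ln (1 - z * w) - Ln (1 - w)"
  proof -
    have "1 - B z = (1 - z * w) / (1 - w)"
      using ne by (simp add: B_def field_simps)
    then show ?thesis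
      using Ln_divide_right_half_plane pos by simp
  qed
  define A' where "A' = - (1 - w) / (1 - z) ^ 2"
  define B' where "B' = w / (1 - w)"
  \<comment> \<open>\<open>A'\<close> and \<open>B'\<close> are written without dividing by \<open>z\<close> or \<open>w\<close>, which may be zero.\<close>
  have dA: "(A has_field_derivative A') (at z)"
    unfolding A_def A'_def using ne
    by (auto intro!: derivative_eq_intros simp: field_simps power2_eq_square)
  have dB: "(B has_field_derivative B') (at z)"
    unfolding B_def B'_def using ne by (auto intro!: derivative_eq_intros)
  have dLn: "((\<lambda>z. Ln (1 - z)) has_field_derivative - 1 / (1 - z)) (at z)"
    using pos(1) by (auto intro!: derivative_eq_intros simp: complex_nonpos_Reals_iff field_simps)
  have dsq: "((\<lambda>z. 1 / 2 * (Ln (1 - z) - Ln (1 - w)) ^ 2) has_field_derivative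
      (Ln (1 - z) - Ln (1 - w)) * (- 1 / (1 - z))) (at z)"
    by (rule DERIV_cong[OF DERIV_cmult[OF DERIV_power[OF DERIV_diff[OF dLn DERIV_const]]]])
       (use ne in \<open>simp add: divide_simps, simp add: algebra_simps\<close>)
  have dp: "((\<lambda>z. Li2 (z * w)) has_field_derivative Dp * w) (at z)"
    by (rule DERIV_chain2[where g = "\<lambda>z. z * w", OF Dp(1)]) (auto intro!: derivative_eq_intros)
  define D where
    "D = DA * A' + DB * B' + Dz + (Ln (1 - z) - Ln (1 - w)) * (- 1 / (1 - z)) - Dp * w"
  have "((\<lambda>z. Li2 (A z) + Li2 (B z) + Li2 z + Li2 w
           + 1 / 2 * (Ln (1 - z) - Ln (1 - w)) ^ 2 - Li2 (z * w)) has_field_derivative D) (at z)"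
    unfolding D_def
    using DERIV_diff[OF DERIV_add[OF DERIV_add[OF DERIV_add[OF DERIV_add[OF
      DERIV_chain2[OF DA(1) dA] DERIV_chain2[OF DB(1) dB]] Dz(1)] DERIV_const] dsq] dp]
    by simp
  then have deriv: "((\<lambda>z. five_term_defect z w) has_field_derivative D) (at z)"
    by (simp add: five_term_defect_def A_def B_def)
  have "z * A' = A z / (1 - z)"
    using ne by (simp add: A_def A'_def field_simps power2_eq_square)
  then have tA: "z * (DA * A') = - Ln (1 - A z) / (1 - z)"
    using DA(2) by (metis mult.left_commute mult.commute times_divide_eq_right)
  have "B' = - B z / (1 - z)"
    using ne by (simp add: B_def B'_def)
  then have tB: "DB * B' = Ln (1 - B z) / (1 - z)"
    using DB(2) by (simp add: mult.commute)
  have cancel: "- (P - a) / (1 - z) + z * ((P - b) / (1 - z)) + - a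
      + z * ((a - b) * (- 1 / (1 - z))) - - P = 0" for P a b
    using ne by (simp add: divide_simps, simp add: algebra_simps)
  have tp: "z * (Dp * w) = - Ln (1 - z * w)"
    using Dp(2) by (simp add: mult_ac)
  have "z * D = z * (DA * A') + z * (DB * B') + z * Dz
      + z * ((Ln (1 - z) - Ln (1 - w)) * (- 1 / (1 - z))) - z * (Dp * w)"
    unfolding D_def by (simp only: distrib_left right_diff_distrib)
  also have "\<dots> = 0"
    unfolding tA tB tp Dz(2) LnA LnB by (rule cancel)
  finally show ?thesis
    using deriv that by blast
qed

text \<open>
  The derivative vanishes off the origin, and a single exceptional point is harmless for a
  function continuous there.
\<close>

lemma five_term_defect_eq_at_0:
  assumes z: "norm z < 1 / 3" and w: "norm w < 1 / 3"
  shows "five_term_defect z w = five_term_defect 0 w"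
proof (rule has_derivative_zero_unique_strong_convex[where S = "ball 0 (1 / 3)" and K = "{0}"
      and f = "\<lambda>z. five_term_defect z w" and c = 0])
  show "continuous_on (ball 0 (1 / 3)) (\<lambda>z. five_term_defect z w)"
  proof (rule continuous_at_imp_continuous_on, rule ballI)
    fix x :: complex assume "x \<in> ball 0 (1 / 3)"
    then obtain D where "((\<lambda>z. five_term_defect z w) has_field_derivative D) (at x)"
      using five_term_defect_derivative[OF _ w, of x] by auto
    then show "isCont (\<lambda>z. five_term_defect z w) x"
      by (rule DERIV_isCont)
  qed
next
  fix x :: complex assume x: "x \<in> ball 0 (1 / 3) - {0}"
  then obtain D where D: "((\<lambda>z. five_term_defect z w) has_field_derivative D) (at x)" "x * D = 0"
    using five_term_defect_derivative[OF _ w, of x] by auto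
  then have "D = 0"
    using x by simp
  then have "((\<lambda>z. five_term_defect z w) has_derivative (\<lambda>h. 0)) (at x)"
    using D(1) by (simp add: has_field_derivative_def lambda_zero)
  then show "((\<lambda>z. five_term_defect z w) has_derivative (\<lambda>h. 0)) (at x within ball 0 (1 / 3))"
    by (rule has_derivative_at_withinI)
qed (use z in auto)

lemma five_term_defect_eq_0:
  assumes "norm z < 1 / 3" and "norm w < 1 / 3"
  shows "five_term_defect z w = 0"
proof -
  have "five_term_defect z w = five_term_defect w 0"
    using five_term_defect_eq_at_0[OF assms] five_term_defect_commute by simp
  also have "\<dots> = five_term_defect 0 0"
    using assms(2) by (intro five_term_defect_eq_at_0) simp_all
  finally show ?thesis
    by (simp add: five_term_defect_0_0)
qed

theorem theorem19:
  shows "\<forall>\<^sub>F (z1, z2) in nhds (0 :: complex, 0 :: complex).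
    Li2 (z1 * z2) =
      Li2 (- z1 * (1 - z2) / (1 - z1)) + Li2 (- z2 * (1 - z1) / (1 - z2))
      + Li2 z1 + Li2 z2 + 1 / 2 * (Ln ((1 - z1) / (1 - z2))) ^ 2"
proof -
  have "open (ball (0 :: complex) (1 / 3) \<times> ball (0 :: complex) (1 / 3))"
    by (intro open_Times open_ball)
  then have "\<forall>\<^sub>F p in nhds (0 :: complex, 0 :: complex). p \<in> ball 0 (1 / 3) \<times> ball 0 (1 / 3)"
    by (rule eventually_nhds_in_open) simp
  then show ?thesis
  proof (rule eventually_mono, clarify)
    fix z1 z2 :: complex
    assume "z1 \<in> ball 0 (1 / 3)" and "z2 \<in> ball 0 (1 / 3)"
    then have z: "norm z1 < 1 / 3" "norm z2 < 1 / 3"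
      by simp_all
    have "Ln ((1 - z1) / (1 - z2)) = Ln (1 - z1) - Ln (1 - z2)"
      using z by (intro Ln_divide_right_half_plane Re_one_minus_pos) simp_all
    then show "Li2 (z1 * z2) =
      Li2 (- z1 * (1 - z2) / (1 - z1)) + Li2 (- z2 * (1 - z1) / (1 - z2))
      + Li2 z1 + Li2 z2 + 1 / 2 * (Ln ((1 - z1) / (1 - z2))) ^ 2"
      using five_term_defect_eq_0[OF z] by (simp add: five_term_defect_def)
  qed
qed

end
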